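(* Let $\theta\in\mathbb{R}\setminus\{0\}$. For every integer $n\ge1$ and every $k\in\mathbb{R}$, $$\frac1{t_n(\theta,k)}=\frac{1+\theta^2}{2\theta}\,U_{n-1}\!\left(\frac{1+\theta^2}{2\theta}\cos k\right)e^{i(n-1)k}-U_{n-2}\!\left(\frac{1+\theta^2}{2\theta}\cos k\right)e^{ink},$$ $$\frac{r_n(\theta,k)}{t_n(\theta,k)}=\frac{1-\theta^2}{2\theta}\,U_{n-1}\!\left(\frac{1+\theta^2}{2\theta}\cos k\right)e^{i(n-1)k},$$ where $U_m$ denotes the Chebyshev polynomial of the second kind of degree $m$. The transmission probability equals $$T_n(\theta,k)=\frac1{1+\dfrac{(1-\theta^2)^2}{4\theta^2}\,U_{n-1}^2\!\left(\dfrac{1+\theta^2}{2\theta}\cos k\right)}.$$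
   Context: For an integer $n\ge1$, $\theta\in\mathbb{R}\setminus\{0\}$ and $k\in\mathbb{R}$, consider the scattering problem $$\psi''+k^2\psi=0\ \text{ on }\mathbb{R}\setminus\{0,1,\dots,n-1\},\qquad \psi(j+0)=\theta\psi(j-0),\quad \psi'(j+0)=\theta^{-1}\psi'(j-0),\quad j=0,\dots,n-1,$$ with left scattering solution $\psi_-(x)=e^{ikx}+r_n(\theta,k)e^{-ikx}$ for $x<0$ and $\psi_-(x)=t_n(\theta,k)e^{ikx}$ for $x>n-1$. The reflection amplitude $r_n$ and transmission amplitude $t_n$ are determined (for all $k\in\mathbb{R}$) by $$\begin{bmatrix} t_n(\theta,k)\\0\end{bmatrix}=M_n(\theta,k)\begin{bmatrix}1\\ r_n(\theta,k)\end{bmatrix},\qquad M_n(\theta,k)=M(\theta,(n-1)k)\cdots M(\theta,2k)\,M(\theta,k)\,M(\theta,0),$$ where $$M(\theta,z)=\frac1{2\theta}\begin{bmatrix}\theta^2+1&(\theta^2-1)e^{-2iz}\\(\theta^2-1)e^{2iz}&\theta^2+1\end{bmatrix}.$$ The amplitude $t_n(\theta,k)$ never vanishes for real $k$. The transmission probability is $T_n(\theta,k)=|t_n(\theta,k)|^2$. The Chebyshev polynomials of the second kind are defined by $\sin\phi\,U_m(\cos\phi)=\sin((m+1)\phi)$, with the convention $U_{-1}=0$. *)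

theory Defs
  imports "HOL-Analysis.Analysis" "HOL-Computational_Algebra.Polynomial"
begin

text \<open>
  Chebyshev polynomials of the second kind. They are genuine real polynomials, since they are
  evaluated at points that may lie outside \<open>[-1, 1]\<close>. The index is an integer so that
  \<open>U\<^sub>-\<^sub>1\<close> is available; there the defining identity forces \<open>U\<^sub>-\<^sub>1 = 0\<close>.
\<close>

definition chebyshev_U :: "int \<Rightarrow> real poly" where
  "chebyshev_U m =
     (THE p. \<forall>\<phi>. sin \<phi> * poly p (cos \<phi>) = sin (of_int (m + 1) * \<phi>))"

lemma chebyshev_U_unique:
  fixes p q :: "real poly"
  assumes "\<forall>\<phi>. sin \<phi> * poly p (cos \<phi>) = f \<phi>" "\<forall>\<phi>. sin \<phi> * poly q (cos \<phi>) = f \<phi>"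
  shows "p = q"
proof (rule ccontr)
  assume "p \<noteq> q"
  then have fin: "finite {x. poly (p - q) x = 0}"
    by (intro poly_roots_finite) simp
  have "{-1<..<1} \<subseteq> {x. poly (p - q) x = 0}"
  proof
    fix x :: real assume x: "x \<in> {-1<..<1}"
    have "sin (arccos x) \<noteq> 0"
      using x by (intro sin_arccos_nonzero) auto
    moreover have "sin (arccos x) * poly p (cos (arccos x)) = sin (arccos x) * poly q (cos (arccos x))"
      using assms by metis
    ultimately show "x \<in> {x. poly (p - q) x = 0}"
      using x by simp
  qed
  then have "finite {-1<..<1::real}"
    using fin finite_subset by blast
  then show False
    using infinite_Ioo[of "-1::real" 1] by simp
qed

lemma chebyshev_U_exists:
  "\<exists>p::real poly. \<forall>\<phi>. sin \<phi> * poly p (cos \<phi>) = sin (real n * \<phi>)"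
proof (induction n rule: less_induct)
  case (less n)
  consider "n = 0" | "n = 1" | m where "n = Suc (Suc m)"
    by (metis One_nat_def not0_implies_Suc)
  then show ?case
  proof cases
    case 1
    then show ?thesis by (intro exI[of _ 0]) simp
  next
    case 2
    then show ?thesis by (intro exI[of _ 1]) simp
  next
    case 3
    obtain p q :: "real poly"
      where p: "\<And>\<phi>. sin \<phi> * poly p (cos \<phi>) = sin (real m * \<phi>)"
        and q: "\<And>\<phi>. sin \<phi> * poly q (cos \<phi>) = sin (real (Suc m) * \<phi>)"
      using less[of m] less[of "Suc m"] 3 by auto
    have "sin \<phi> * poly ([:0, 2:] * q - p) (cos \<phi>) = sin (real n * \<phi>)" for \<phi>
    proof -
      have "sin \<phi> * poly ([:0, 2:] * q - p) (cos \<phi>) =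
          2 * cos \<phi> * (sin \<phi> * poly q (cos \<phi>)) - sin \<phi> * poly p (cos \<phi>)"
        by (simp add: algebra_simps)
      also have "\<dots> = 2 * cos \<phi> * sin (real (Suc m) * \<phi>) - sin (real (Suc m) * \<phi> - \<phi>)"
        by (simp add: p q algebra_simps)
      also have "\<dots> = sin (real (Suc m) * \<phi> + \<phi>)"
        by (simp add: sin_add sin_diff)
      also have "\<dots> = sin (real n * \<phi>)"
        by (simp add: 3 algebra_simps)
      finally show ?thesis .
    qed
    then show ?thesis by blast
  qed
qed

lemma chebyshev_U_sin:
  assumes "m \<ge> -1"
  shows "sin \<phi> * poly (chebyshev_U m) (cos \<phi>) = sin (of_int (m + 1) * \<phi>)"
proof -
  have "\<exists>!p::real poly. \<forall>\<phi>. sin \<phi> * poly p (cos \<phi>) = sin (of_int (m + 1) * \<phi>)"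
    using chebyshev_U_exists[of "nat (m + 1)"] assms chebyshev_U_unique
    by (intro ex_ex1I) auto
  from theI'[OF this] show ?thesis
    unfolding chebyshev_U_def by blast
qed

definition transfer_matrix :: "real \<Rightarrow> real \<Rightarrow> complex^2^2" where
  "transfer_matrix \<theta> z = vector
     [vector [(\<theta>\<^sup>2 + 1) / (2 * \<theta>), (\<theta>\<^sup>2 - 1) / (2 * \<theta>) * exp (- 2 * \<i> * z)],
      vector [(\<theta>\<^sup>2 - 1) / (2 * \<theta>) * exp (2 * \<i> * z), (\<theta>\<^sup>2 + 1) / (2 * \<theta>)]]"

text \<open>\<open>transfer_prod n \<theta> k = M(\<theta>, (n - 1) k) \<cdots> M(\<theta>, k) M(\<theta>, 0)\<close>\<close>

primrec transfer_prod :: "nat \<Rightarrow> real \<Rightarrow> real \<Rightarrow> complex^2^2" where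
  "transfer_prod 0 \<theta> k = mat 1"
| "transfer_prod (Suc n) \<theta> k = transfer_matrix \<theta> (real n * k) ** transfer_prod n \<theta> k"

definition scattering_amplitudes :: "nat \<Rightarrow> real \<Rightarrow> real \<Rightarrow> complex \<times> complex" where
  "scattering_amplitudes n \<theta> k =
     (THE (t, r). vector [t, 0] = transfer_prod n \<theta> k *v (vector [1, r] :: complex^2))"

definition transmission_amplitude :: "nat \<Rightarrow> real \<Rightarrow> real \<Rightarrow> complex" where
  "transmission_amplitude n \<theta> k = fst (scattering_amplitudes n \<theta> k)"

definition reflection_amplitude :: "nat \<Rightarrow> real \<Rightarrow> real \<Rightarrow> complex" where
  "reflection_amplitude n \<theta> k = snd (scattering_amplitudes n \<theta> k)"

definition transmission_probability :: "nat \<Rightarrow> real \<Rightarrow> real \<Rightarrow> real" where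
  "transmission_probability n \<theta> k = (cmod (transmission_amplitude n \<theta> k))\<^sup>2"

lemma transfer_prod_form:
  assumes "\<theta> \<noteq> 0"
  shows "\<exists>a b. transfer_prod n \<theta> k = vector [vector [a, b], vector [cnj b, cnj a]] \<and>
               (cmod a)\<^sup>2 - (cmod b)\<^sup>2 = 1"
proof (induction n)
  case 0
  show ?case
    by (intro exI[of _ 1] exI[of _ 0]) (simp add: vec_eq_iff forall_2 mat_def)
next
  case (Suc n)
  then obtain a b
    where ab: "transfer_prod n \<theta> k = vector [vector [a, b], vector [cnj b, cnj a]]"
      and 1: "(cmod a)\<^sup>2 - (cmod b)\<^sup>2 = 1" by blast
  define c where "c = complex_of_real ((\<theta>\<^sup>2 + 1) / (2 * \<theta>))"
  define d where "d = (\<theta>\<^sup>2 - 1) / (2 * \<theta>) * exp (- 2 * \<i> * (real n * k))"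
  have M: "transfer_matrix \<theta> (real n * k) = vector [vector [c, d], vector [cnj d, cnj c]]"
    by (simp add: transfer_matrix_def c_def d_def exp_cnj)
  have cd: "c * cnj c - d * cnj d = 1"
  proof -
    have "d * cnj d = complex_of_real (((\<theta>\<^sup>2 - 1) / (2 * \<theta>))\<^sup>2)"
      by (simp add: d_def exp_cnj power2_eq_square field_simps flip: exp_add)
    then have "c * cnj c - d * cnj d =
        of_real (((\<theta>\<^sup>2 + 1) / (2 * \<theta>))\<^sup>2 - ((\<theta>\<^sup>2 - 1) / (2 * \<theta>))\<^sup>2)"
      by (simp add: c_def power2_eq_square)
    also have "((\<theta>\<^sup>2 + 1) / (2 * \<theta>))\<^sup>2 - ((\<theta>\<^sup>2 - 1) / (2 * \<theta>))\<^sup>2 = 1"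
      using assms by (simp add: power2_eq_square field_simps)
    finally show ?thesis by simp
  qed
  have ab1: "a * cnj a - b * cnj b = 1"
    by (simp only: 1 of_real_1 flip: complex_norm_square of_real_diff)
  let ?a = "c * a + d * cnj b" and ?b = "c * b + d * cnj a"
  have "transfer_prod (Suc n) \<theta> k = vector [vector [?a, ?b], vector [cnj ?b, cnj ?a]]"
    unfolding transfer_prod.simps ab M
    by (simp add: vec_eq_iff forall_2 matrix_matrix_mult_def sum_2 algebra_simps)
  moreover have "?a * cnj ?a - ?b * cnj ?b =
      (c * cnj c - d * cnj d) * (a * cnj a - b * cnj b)"
    by (simp add: algebra_simps)
  then have "complex_of_real ((cmod ?a)\<^sup>2 - (cmod ?b)\<^sup>2) = 1"
    by (simp only: cd ab1 of_real_diff complex_norm_square) simp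
  then have "(cmod ?a)\<^sup>2 - (cmod ?b)\<^sup>2 = 1"
    using of_real_eq_1_iff by blast
  ultimately show ?case by blast
qed

lemma scattering_amplitudes_ex1:
  assumes "\<theta> \<noteq> 0"
  shows "\<exists>!(t, r). vector [t, 0] = transfer_prod n \<theta> k *v (vector [1, r] :: complex^2)"
proof -
  obtain a b where ab: "transfer_prod n \<theta> k = vector [vector [a, b], vector [cnj b, cnj a]]"
      and 1: "(cmod a)\<^sup>2 - (cmod b)\<^sup>2 = 1"
    using transfer_prod_form[OF assms] by blast
  have "a \<noteq> 0"
  proof
    assume "a = 0"
    then show False using 1 zero_le_power2[of "cmod b"] by simp
  qed
  have "vector [t, 0] = transfer_prod n \<theta> k *v (vector [1, r] :: complex^2) \<longleftrightarrow>
      r = - cnj b / cnj a \<and> t = a + b * (- cnj b / cnj a)" for t r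
  proof -
    have "vector [t, 0] = transfer_prod n \<theta> k *v (vector [1, r] :: complex^2) \<longleftrightarrow>
        t = a + b * r \<and> 0 = cnj b + cnj a * r"
      by (simp add: ab vec_eq_iff forall_2 matrix_vector_mult_def sum_2)
    also have "0 = cnj b + cnj a * r \<longleftrightarrow> r = - cnj b / cnj a"
      using \<open>a \<noteq> 0\<close> by (auto simp: field_simps eq_neg_iff_add_eq_0 add.commute)
    finally show ?thesis by blast
  qed
  then show ?thesis by (intro ex1I[of _ "(a + b * (- cnj b / cnj a), - cnj b / cnj a)"]) auto
qed

lemma scattering_amplitudes_eq:
  assumes "\<theta> \<noteq> 0"
  shows "vector [transmission_amplitude n \<theta> k, 0] =
         transfer_prod n \<theta> k *v (vector [1, reflection_amplitude n \<theta> k] :: complex^2)"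
  using theI'[OF scattering_amplitudes_ex1[OF assms, of n k]]
  unfolding transmission_amplitude_def reflection_amplitude_def scattering_amplitudes_def
  by (simp only: case_prod_beta')

end

theory Submission
  imports Defs
begin

text \<open>
  The transfer product has the form \<open>(a, b; cnj b, cnj a)\<close> with determinant one, so
  \<open>1 / t = cnj a\<close> and \<open>r / t = - cnj b\<close>. With \<open>c = (\<theta>\<^sup>2 + 1) / (2 \<theta>)\<close>,
  \<open>d = (\<theta>\<^sup>2 - 1) / (2 \<theta>)\<close> and \<open>w = exp (i k)\<close>, one more factor in the product turns into
  the three-term recurrence of the Chebyshev polynomials at \<open>c cos k = c (w + 1 / w) / 2\<close>, thanks
  to \<open>c\<^sup>2 - d\<^sup>2 = 1\<close>. The transmission probability is \<open>1 / \<bar>a\<bar>\<^sup>2 = 1 / (1 + \<bar>b\<bar>\<^sup>2)\<close>.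
\<close>

lemma chebyshev_U_eqI:
  assumes "m \<ge> -1" "\<And>\<phi>. sin \<phi> * poly p (cos \<phi>) = sin (of_int (m + 1) * \<phi>)"
  shows "chebyshev_U m = p"
  using chebyshev_U_unique[of "chebyshev_U m" "\<lambda>\<phi>. sin (of_int (m + 1) * \<phi>)" p]
    chebyshev_U_sin assms by blast

lemma chebyshev_U_minus_1 [simp]: "chebyshev_U (- 1) = 0"
  by (rule chebyshev_U_eqI) auto

lemma chebyshev_U_0 [simp]: "chebyshev_U 0 = 1"
  by (rule chebyshev_U_eqI) auto

text \<open>This is \<open>sin (x + \<phi>) + sin (x - \<phi>) = 2 * cos \<phi> * sin x\<close> at
  \<open>x = (m + 1) * \<phi>\<close>. As an identity of polynomials it can also be evaluated
  outside [-1, 1], where \<open>c * cos k\<close> may lie.\<close>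

lemma chebyshev_U_rec:
  assumes "m \<ge> 0"
  shows "chebyshev_U (m + 1) = [:0, 2:] * chebyshev_U m - chebyshev_U (m - 1)"
proof (rule chebyshev_U_eqI)
  fix \<phi> :: real
  have "sin \<phi> * poly ([:0, 2:] * chebyshev_U m - chebyshev_U (m - 1)) (cos \<phi>) =
      2 * cos \<phi> * (sin \<phi> * poly (chebyshev_U m) (cos \<phi>))
        - sin \<phi> * poly (chebyshev_U (m - 1)) (cos \<phi>)"
    by (simp add: algebra_simps)
  also have "\<dots> = 2 * cos \<phi> * sin (of_int (m + 1) * \<phi>) - sin (of_int (m + 1) * \<phi> - \<phi>)"
    using assms by (simp add: chebyshev_U_sin algebra_simps)
  also have "\<dots> = sin (of_int (m + 1) * \<phi> + \<phi>)"
    by (simp add: sin_add sin_diff)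
  also have "\<dots> = sin (of_int (m + 1 + 1) * \<phi>)"
    by (simp add: algebra_simps)
  finally show "sin \<phi> * poly ([:0, 2:] * chebyshev_U m - chebyshev_U (m - 1)) (cos \<phi>) =
      sin (of_int (m + 1 + 1) * \<phi>)" .
qed (use assms in simp)

lemma exp_i_eq_cis_power: "exp (\<i> * complex_of_real (real j * x)) = cis x ^ j"
  by (simp only: Complex.DeMoivre flip: cis_conv_exp)

text \<open>\<open>A m\<close> and \<open>B m\<close> are the claimed values of \<open>1 / t\<close>
  and \<open>- r / t\<close> for \<open>m + 1\<close> scatterers. Starting from one scatterer keeps
  the index \<open>int m - 1\<close> at least \<open>-1\<close>, the range covered by
  \<open>chebyshev_U_sin\<close>.\<close>

lemma transfer_prod_chebyshev_U:
  fixes \<theta> k :: real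
  defines "c \<equiv> (\<theta>\<^sup>2 + 1) / (2 * \<theta>)" and "d \<equiv> (\<theta>\<^sup>2 - 1) / (2 * \<theta>)"
  defines "U \<equiv> \<lambda>m. complex_of_real (poly (chebyshev_U m) (c * cos k))"
  defines "A \<equiv> \<lambda>m. c * U (int m) * cis k ^ m - U (int m - 1) * cis k ^ Suc m"
    and "B \<equiv> \<lambda>m. d * U (int m) * cis k ^ m"
  assumes "\<theta> \<noteq> 0"
  shows "transfer_prod (Suc m) \<theta> k = vector [vector [cnj (A m), cnj (B m)], vector [B m, A m]]"
proof (induction m)
  case 0
  show ?case
    by (simp add: transfer_matrix_def A_def B_def U_def c_def d_def)
next
  case (Suc m)
  define w where "w = cis k"
  \<comment> \<open>Since \<open>w\<close> has modulus 1, \<open>v\<close> is its inverse, so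
    conjugation becomes polynomial algebra in \<open>v\<close> and \<open>w\<close>.\<close>
  define v where "v = cnj w"
  have vw: "v * w = 1"
    by (simp add: v_def w_def cis_cnj cis_mult)
  have cd: "complex_of_real c ^ 2 - complex_of_real d ^ 2 = 1"
  proof -
    have "c\<^sup>2 - d\<^sup>2 = 1"
      using assms by (simp add: c_def d_def power2_eq_square field_simps)
    then show ?thesis
      by (metis of_real_1 of_real_diff of_real_power)
  qed
  have wv: "complex_of_real (2 * cos k) = w + v"
    by (simp add: w_def v_def complex_eq_iff)
  have U: "U (int (Suc m)) = c * (w + v) * U (int m) - U (int m - 1)"
  proof -
    have "poly (chebyshev_U (int (Suc m))) (c * cos k) =
        c * (2 * cos k) * poly (chebyshev_U (int m)) (c * cos k)
          - poly (chebyshev_U (int m - 1)) (c * cos k)"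
      using chebyshev_U_rec[of "int m"] by (simp add: add.commute)
    then show ?thesis
      by (simp only: U_def of_real_mult of_real_diff flip: wv)
  qed
  have U_cnj: "cnj (U j) = U j" for j
    by (simp add: U_def)
  have vw_pow: "w ^ m * v ^ m = 1"
    by (simp add: vw mult.commute flip: power_mult_distrib)
  have M: "transfer_matrix \<theta> (real (Suc m) * k) =
      vector [vector [of_real c, d * cnj (w ^ (2 * Suc m))], vector [d * w ^ (2 * Suc m), of_real c]]"
  proof -
    have e: "exp (2 * \<i> * complex_of_real (real (Suc m) * k)) = w ^ (2 * Suc m)"
      using exp_i_eq_cis_power[of "2 * Suc m" k] by (simp add: w_def algebra_simps)
    have "exp (- 2 * \<i> * complex_of_real (real (Suc m) * k)) =
        cnj (exp (2 * \<i> * complex_of_real (real (Suc m) * k)))"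
      by (simp add: exp_cnj)
    with e show ?thesis
      unfolding transfer_matrix_def c_def d_def by simp
  qed
  \<comment> \<open>The phase of the new factor turns the negative powers of \<open>w\<close> in the
    conjugated entries into positive ones.\<close>
  have wwv: "w ^ (2 * Suc m) * v ^ m = w ^ m * w\<^sup>2"
    using vw_pow by (simp add: power_mult power2_eq_square power_mult_distrib)
  have wwv': "w ^ (2 * Suc m) * v ^ Suc m = w ^ m * w"
  proof -
    have "w ^ (2 * Suc m) * v ^ Suc m = w ^ (2 * Suc m) * v ^ m * v"
      by (simp only: power_Suc2 mult.assoc)
    also have "\<dots> = w ^ m * w * (v * w)"
      unfolding wwv by (simp add: power2_eq_square)
    finally show ?thesis
      by (simp add: vw)
  qed
  \<comment> \<open>Writing 1 as \<open>v * w\<close> gives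
    \<open>w\<^sup>2 + v * w = w * (w + v)\<close>, so the recurrence \<open>U\<close> applies after
    factoring out \<open>w\<close>.\<close>
  have B: "d * w ^ (2 * Suc m) * cnj (A m) + c * B m = B (Suc m)"
  proof -
    have "d * w ^ (2 * Suc m) * cnj (A m) =
        d * c * U (int m) * (w ^ (2 * Suc m) * v ^ m)
          - d * U (int m - 1) * (w ^ (2 * Suc m) * v ^ Suc m)"
      by (simp add: A_def U_cnj v_def w_def algebra_simps)
    also have "\<dots> + c * B m = d * w ^ m * (c * U (int m) * (w\<^sup>2 + v * w) - U (int m - 1) * w)"
      unfolding wwv wwv' by (simp add: B_def vw algebra_simps flip: w_def)
    also have "\<dots> = B (Suc m)"
      unfolding B_def U by (simp add: power2_eq_square algebra_simps flip: w_def)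
    finally show ?thesis .
  qed
  \<comment> \<open>After replacing \<open>d\<^sup>2\<close> by \<open>c\<^sup>2 - 1\<close>, the
    terms with a factor \<open>c\<close> combine by the recurrence as for \<open>B\<close>; the
    leftover \<open>- U (int m) * w\<^sup>2\<close> is the second term of
    \<open>A (Suc m)\<close>.\<close>
  have A: "d * w ^ (2 * Suc m) * cnj (B m) + c * A m = A (Suc m)"
  proof -
    have "d * w ^ (2 * Suc m) * cnj (B m) + c * A m =
        d\<^sup>2 * U (int m) * (w ^ (2 * Suc m) * v ^ m) + c * A m"
      by (simp add: B_def U_cnj v_def w_def power2_eq_square algebra_simps)
    also have "\<dots> = w ^ m * (of_real d ^ 2 * U (int m) * w\<^sup>2 + of_real c ^ 2 * U (int m) * (v * w)
        - c * U (int m - 1) * w)"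
      unfolding wwv by (simp add: A_def vw power2_eq_square algebra_simps flip: w_def)
    also have "of_real d ^ 2 = complex_of_real c ^ 2 - 1"
      using cd by algebra
    also have "w ^ m * ((complex_of_real c ^ 2 - 1) * U (int m) * w\<^sup>2
        + of_real c ^ 2 * U (int m) * (v * w) - c * U (int m - 1) * w) = A (Suc m)"
      unfolding A_def U by (simp add: power2_eq_square algebra_simps flip: w_def)
    finally show ?thesis .
  qed
  \<comment> \<open>The upper row is the conjugate of the lower one, because \<open>c\<close> and
    \<open>d\<close> are real.\<close>
  have cnj_B: "c * cnj (B m) + d * cnj (w ^ (2 * Suc m)) * A m = cnj (B (Suc m))"
    unfolding B[symmetric] by simp
  have cnj_A: "c * cnj (A m) + d * cnj (w ^ (2 * Suc m)) * B m = cnj (A (Suc m))"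
    unfolding A[symmetric] by simp
  show ?case
    unfolding transfer_prod.simps(2)[of "Suc m"] Suc.IH M
    by (simp add: vec_eq_iff forall_2 matrix_matrix_mult_def sum_2 cnj_A cnj_B A B
        del: power_Suc complex_cnj_power mult_Suc_right)
qed

lemma amplitudes_of_transfer_prod:
  assumes "\<theta> \<noteq> 0"
    and T: "transfer_prod n \<theta> k = vector [vector [cnj a, cnj b], vector [b, a]]"
  shows "1 / transmission_amplitude n \<theta> k = a"
    and "reflection_amplitude n \<theta> k / transmission_amplitude n \<theta> k = - b"
    and "transmission_probability n \<theta> k = 1 / (1 + (cmod b)\<^sup>2)"
proof -
  let ?t = "transmission_amplitude n \<theta> k" and ?r = "reflection_amplitude n \<theta> k"
  \<comment> \<open>Comparing entries identifies \<open>a'\<close> and \<open>b'\<close> with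
    \<open>cnj a\<close> and \<open>cnj b\<close>, which yields the determinant condition for
    \<open>a\<close> and \<open>b\<close>.\<close>
  obtain a' b' where "transfer_prod n \<theta> k = vector [vector [a', b'], vector [cnj b', cnj a']]"
    and "(cmod a')\<^sup>2 - (cmod b')\<^sup>2 = 1"
    using transfer_prod_form[OF \<open>\<theta> \<noteq> 0\<close>] by blast
  then have norm: "(cmod a)\<^sup>2 = 1 + (cmod b)\<^sup>2"
    by (simp add: T vec_eq_iff forall_2)
  then have det: "a * cnj a = 1 + b * cnj b"
    by (metis complex_norm_square of_real_1 of_real_add)
  have "a \<noteq> 0"
    using norm by (metis norm_zero power_zero_numeral add_pos_nonneg less_irrefl zero_le_power2
        zero_less_one)
  have t: "?t = cnj a + cnj b * ?r" and r: "b + a * ?r = 0"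
    using scattering_amplitudes_eq[OF \<open>\<theta> \<noteq> 0\<close>, of n k]
    by (simp_all add: T vec_eq_iff forall_2 matrix_vector_mult_def sum_2)
  \<comment> \<open>Multiply \<open>t\<close> by \<open>a\<close> and replace \<open>a * ?r\<close>
    by \<open>- b\<close>: what remains is the determinant.\<close>
  have at: "a * ?t = 1"
    using t r det by algebra
  then have "?t \<noteq> 0"
    by auto
  show inv_t: "1 / ?t = a"
    using at \<open>?t \<noteq> 0\<close> by (simp add: field_simps)
  \<comment> \<open>Multiply \<open>r\<close> by \<open>?t\<close> and use
    \<open>a * ?t = 1\<close>.\<close>
  have "?r = - b * ?t"
    using at r by algebra
  then show "?r / ?t = - b"
    using \<open>?t \<noteq> 0\<close> by simp
  have "?t = 1 / a"
    using inv_t by force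
  then show "transmission_probability n \<theta> k = 1 / (1 + (cmod b)\<^sup>2)"
    by (simp add: transmission_probability_def norm_divide power_divide norm)
qed

theorem theorem3:
  fixes \<theta> k :: real and n :: nat
  assumes "\<theta> \<noteq> 0" and "n \<ge> 1"
  shows "1 / transmission_amplitude n \<theta> k =
           complex_of_real ((1 + \<theta>\<^sup>2) / (2 * \<theta>) *
               poly (chebyshev_U (int n - 1)) ((1 + \<theta>\<^sup>2) / (2 * \<theta>) * cos k))
             * exp (\<i> * complex_of_real ((real n - 1) * k))
           - complex_of_real (poly (chebyshev_U (int n - 2)) ((1 + \<theta>\<^sup>2) / (2 * \<theta>) * cos k))
             * exp (\<i> * complex_of_real (real n * k)) \<and>
         reflection_amplitude n \<theta> k / transmission_amplitude n \<theta> k =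
           complex_of_real ((1 - \<theta>\<^sup>2) / (2 * \<theta>) *
               poly (chebyshev_U (int n - 1)) ((1 + \<theta>\<^sup>2) / (2 * \<theta>) * cos k))
             * exp (\<i> * complex_of_real ((real n - 1) * k)) \<and>
         transmission_probability n \<theta> k =
           1 / (1 + (1 - \<theta>\<^sup>2)\<^sup>2 / (4 * \<theta>\<^sup>2) *
             (poly (chebyshev_U (int n - 1)) ((1 + \<theta>\<^sup>2) / (2 * \<theta>) * cos k))\<^sup>2)"
proof -
  obtain m where n: "n = Suc m"
    using \<open>n \<ge> 1\<close> by (cases n) auto
  have idx: "int n - 1 = int m" "int n - 2 = int m - 1" "real n - 1 = real m"
    by (simp_all add: n)
  \<comment> \<open>The minus sign in \<open>r / t = - b\<close> accounts for
    \<open>1 - \<theta>\<^sup>2\<close> in place of the matrix entry's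
    \<open>\<theta>\<^sup>2 - 1\<close>.\<close>
  have neg: "(1 - \<theta>\<^sup>2) / (2 * \<theta>) = - ((\<theta>\<^sup>2 - 1) / (2 * \<theta>))"
    by (simp add: minus_divide_left)
  have sq: "((\<theta>\<^sup>2 - 1) / (2 * \<theta>))\<^sup>2 = (1 - \<theta>\<^sup>2)\<^sup>2 / (4 * \<theta>\<^sup>2)"
    by (simp add: power_divide power_mult_distrib power2_commute)
  have norm_B: "(cmod (complex_of_real x * complex_of_real y * cis k ^ m))\<^sup>2 = x\<^sup>2 * y\<^sup>2" for x y
    by (simp add: norm_mult norm_power power_mult_distrib)
  note amps = amplitudes_of_transfer_prod[OF \<open>\<theta> \<noteq> 0\<close>
      transfer_prod_chebyshev_U[OF \<open>\<theta> \<noteq> 0\<close>, of m k], folded n]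
  show ?thesis
    unfolding idx exp_i_eq_cis_power amps neg add.commute[of 1 "\<theta>\<^sup>2"] norm_B sq
    unfolding of_real_mult by (simp add: n)
qed

end
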